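(* Let $A>0$ and suppose that $g(x)$ is a strictly positive, continuous and strictly increasing cumulative distribution function on $[A,\infty)$. Suppose further that some real-valued function $y(u)$ with $y(u)\to\infty$ as $u\to 1^-$ satisfies $$y(g(x)) = x\left(1+O(\zeta(x))\right)\quad\text{as } x\to\infty,$$ where $\zeta(x)\to 0$ as $x\to\infty$. Suppose that $\zeta(x)=\psi\left(\frac{1}{x}\right)$ with $$\psi(w)=w^{\rho}L(w)$$ for some constant $\rho\ge 0$ and some function $L(w)$, $w>0$, slowly varying at $0$. If $h(u)=g^{-1}(u)$, $u\in[g(A),1)$, is the inverse function of $g$ (the upper tail quantile function), then $$h(u)=y(u)\left(1+O(\zeta(y(u)))\right)\quad\text{as } u\to 1^-.$$
   Context: "Cumulative distribution function on $[A,\infty)$" means that $g$ is the restriction to $[A,\infty)$ of the cumulative distribution function of a real random variable; in particular $g(x)\to 1$ as $x\to\infty$. The function $y(u)$ is defined for $u<1$ close to $1$. A function $L$ is slowly varying at $0$ if it is positive and measurable on $(0,\delta)$ for some $\delta>0$ and $\lim_{w\to0^+}L(\lambda w)/L(w)=1$ for every $\lambda>0$. The notation $y(g(x))=x(1+O(\zeta(x)))$ as $x\to\infty$ means that $|y(g(x))/x-1|\le C|\zeta(x)|$ for some constant $C$ and all sufficiently large $x$; similarly, $h(u)=y(u)(1+O(\zeta(y(u))))$ as $u\to1^-$ means that $|h(u)/y(u)-1|\le C'|\zeta(y(u))|$ for some constant $C'$ and all $u<1$ sufficiently close to $1$. *)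

theory Defs
  imports "HOL-Probability.Probability" "HOL-Library.Landau_Symbols"
begin

definition cdf_on_tail :: "real \<Rightarrow> (real \<Rightarrow> real) \<Rightarrow> bool" where
  "cdf_on_tail A g \<longleftrightarrow> (\<exists>M. real_distribution M \<and> (\<forall>x\<ge>A. g x = cdf M x))"

text \<open>Measurability is Lebesgue measurability, which includes the Borel measurable functions.\<close>

definition slowly_varying_at_0 :: "(real \<Rightarrow> real) \<Rightarrow> bool" where
  "slowly_varying_at_0 L \<longleftrightarrow>
     (\<exists>\<delta>>0. (\<forall>w\<in>{0<..<\<delta>}. L w > 0) \<and> L \<in> borel_measurable (lebesgue_on {0<..<\<delta>})) \<and>
     (\<forall>c>0. ((\<lambda>w. L (c * w) / L w) \<longlongrightarrow> 1) (at_right 0))"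

end

theory Submission
  imports Defs
begin

text \<open>
  Put \<open>x = h u\<close>, so that \<open>g x = u\<close> and \<open>x \<rightarrow> \<infinity>\<close> as \<open>u \<rightarrow> 1\<close> from the left. The hypothesis on \<open>y\<close> reads
  \<open>y u = a x\<close> with \<open>\<bar>a - 1\<bar> \<le> C \<bar>\<zeta> x\<bar>\<close>, and since \<open>\<zeta>\<close> vanishes at infinity, \<open>a\<close> eventually lies
  between \<open>1/2\<close> and \<open>2\<close>. Inverting, \<open>\<bar>h u / y u - 1\<bar> = \<bar>a - 1\<bar> / a \<le> 2 C \<bar>\<zeta> x\<bar>\<close>. This is an error
  estimate at \<open>x\<close>, whereas one at \<open>y u = a x\<close> is wanted, so everything rests on
  \<open>\<zeta> x = O(\<zeta> (a x))\<close> uniformly for \<open>a\<close> between \<open>1/2\<close> and \<open>2\<close>. The uniformity matters because \<open>a\<close>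
  moves with \<open>u\<close>; the lemma \<open>regularly_varying_comparison\<close> supplies it.

  The power in \<open>\<zeta>\<close> is harmless, and for the slowly varying factor \<open>L\<close> this is a weak form of
  Karamata's uniform convergence theorem: the ratios \<open>L (c w) / L w\<close>, known to converge only
  for each fixed \<open>c\<close>, are bounded above and below on compact sets of \<open>c\<close> for small \<open>w\<close>. Here
  measurability of \<open>L\<close> enters. By dominated convergence, the set of \<open>c\<close> in a fixed interval for
  which \<open>L (c w) / L w\<close> is not between \<open>1/2\<close> and \<open>2\<close> has small measure. Given \<open>w\<close> and \<open>c w\<close>, the
  exceptional sets of both are then too small to cover an interval, which leaves a point \<open>v w\<close>
  at which \<open>L\<close> is comparable to both \<open>L w\<close> and \<open>L (c w)\<close>; hence these are comparable to each other.
\<close>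

section \<open>Uniform bounds for slowly varying functions\<close>

text \<open>
  Pointwise convergence of the ratios to \<open>1\<close> becomes convergence in measure: each \<open>c\<close> eventually
  leaves the exceptional set, so its indicator tends to \<open>0\<close> pointwise and is dominated by that of
  the interval. The comparison is stated without division so that it is symmetric in
  \<open>f w\<close> and \<open>f (c * w)\<close>.
\<close>

lemma measure_ratio_deviation_tendsto_0:
  fixes f :: "real \<Rightarrow> real" and a b K :: real
  assumes meas [measurable]: "f \<in> borel_measurable lebesgue"
    and pos: "\<forall>\<^sub>F w in at_right 0. f w > 0"
    and sv: "\<And>c. c > 0 \<Longrightarrow> ((\<lambda>w. f (c * w) / f w) \<longlongrightarrow> 1) (at_right 0)"
    and K: "K > 1" and a: "a > 0"
  defines "E \<equiv> \<lambda>w. {c \<in> {a..b}. \<not> (f w \<le> K * f (c * w) \<and> f (c * w) \<le> K * f w)}"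
  shows "E w \<in> lmeasurable" and "((\<lambda>w. measure lebesgue (E w)) \<longlongrightarrow> 0) (at_right 0)"
proof -
  have [measurable]: "(\<lambda>c. f (c * w)) \<in> borel_measurable lebesgue" for w
  proof -
    have "(\<lambda>c. w *\<^sub>R c) \<in> lebesgue \<rightarrow>\<^sub>M lebesgue" by (rule lebesgue_measurable_scaling)
    from measurable_compose[OF this meas] show ?thesis by (simp add: mult.commute)
  qed
  have [measurable]: "{a..b} \<in> sets lebesgue" by simp
  have E_eq: "E w = {c \<in> space lebesgue. c \<in> {a..b} \<and> \<not> (f w \<le> K * f (c * w) \<and> f (c * w) \<le> K * f w)}" for w
    by (auto simp: E_def)
  have E_sets [measurable]: "E w \<in> sets lebesgue" for w
    unfolding E_eq by measurable
  have E_sub: "E w \<subseteq> {a..b}" for w by (auto simp: E_def)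
  show E_lm: "E w \<in> lmeasurable" for w
    by (rule fmeasurableI2[OF _ E_sub E_sets]) simp
  have ptw: "\<forall>\<^sub>F w in at_right 0. indicator (E w) c = (0::real)" for c
  proof (cases "c > 0")
    case False
    then show ?thesis using a by (auto simp: E_def)
  next
    case True
    have "\<forall>\<^sub>F w in at_right 0. f (c * w) / f w < K"
      using order_tendstoD(2)[OF sv[OF True]] K by simp
    moreover have "\<forall>\<^sub>F w in at_right 0. f (c * w) / f w > 1 / K"
      using order_tendstoD(1)[OF sv[OF True]] K by simp
    ultimately show ?thesis using pos
    proof eventually_elim
      case (elim w)
      then have "f w \<le> K * f (c * w) \<and> f (c * w) \<le> K * f w"
        using K by (simp add: field_simps)
      then show ?case by (simp add: E_def)
    qed
  qed
  have "((\<lambda>t. integral\<^sup>L lebesgue (indicator (E (inverse t)) :: real \<Rightarrow> real)) \<longlongrightarrow> integral\<^sup>L lebesgue (\<lambda>_ :: real. 0 :: real)) at_top"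
  proof (rule integral_dominated_convergence_at_top[where M = lebesgue and f = "\<lambda>_. 0 :: real"
        and s = "\<lambda>t. indicator (E (inverse t)) :: real \<Rightarrow> real" and w = "indicator {a..b}"])
    show "integrable lebesgue (indicator {a..b} :: real \<Rightarrow> real)"
      by (subst lmeasurable_iff_integrable [symmetric]) simp
    show "AE c in lebesgue. ((\<lambda>t. indicator (E (inverse t)) c) \<longlongrightarrow> (0::real)) at_top"
      using ptw by (intro AE_I2 tendsto_eventually) (simp add: eventually_at_right_to_top)
    show "\<forall>\<^sub>F t in at_top. AE c in lebesgue. norm (indicator (E (inverse t)) c :: real) \<le> indicator {a..b} c"
      by (intro always_eventually allI AE_I2) (auto simp: E_def indicator_def)
  qed auto
  then show "((\<lambda>w. measure lebesgue (E w)) \<longlongrightarrow> 0) (at_right 0)"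
    by (simp add: filterlim_at_right_to_top)
qed

text \<open>
  For small \<open>w\<close> the exceptional sets belonging to \<open>w\<close> and to \<open>c * w\<close> cannot cover all admissible
  intermediate points, and an intermediate point costs a factor \<open>2\<close> on either side, whence the
  constant \<open>4\<close>.
\<close>

lemma locally_bounded_ratio:
  fixes f :: "real \<Rightarrow> real"
  assumes meas: "f \<in> borel_measurable lebesgue"
    and pos: "\<forall>\<^sub>F w in at_right 0. f w > 0"
    and sv: "\<And>c. c > 0 \<Longrightarrow> ((\<lambda>w. f (c * w) / f w) \<longlongrightarrow> 1) (at_right 0)"
  shows "\<forall>\<^sub>F w in at_right 0. \<forall>c\<in>{1..2}. f w \<le> 4 * f (c * w) \<and> f (c * w) \<le> 4 * f w"
proof -
  define E where "E w = {c \<in> {1..4}. \<not> (f w \<le> 2 * f (c * w) \<and> f (c * w) \<le> 2 * f w)}" for w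
  have E_lm: "E w \<in> lmeasurable" for w
    unfolding E_def by (rule measure_ratio_deviation_tendsto_0[OF meas pos sv]) auto
  have "((\<lambda>w. measure lebesgue (E w)) \<longlongrightarrow> 0) (at_right 0)"
    unfolding E_def by (rule measure_ratio_deviation_tendsto_0[OF meas pos sv]) auto
  then have "\<forall>\<^sub>F w in at_right 0. measure lebesgue (E w) < 1/2"
    by (rule order_tendstoD) simp
  then obtain d where d: "d > 0" "\<And>w. 0 < w \<Longrightarrow> w < d \<Longrightarrow> measure lebesgue (E w) < 1/2"
    unfolding eventually_at_right_field by auto
  have "f w \<le> 4 * f (c * w) \<and> f (c * w) \<le> 4 * f w"
    if w: "0 < w" "w < d / 2" and c: "c \<in> {1..2}" for w c
  proof -
    have "c * w \<le> 2 * w" using c w by simp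
    then have "c * w < d" using w(2) by linarith
    then have cw: "0 < c * w" "c * w < d" using c w by auto
    \<comment> \<open>A multiplier \<open>v\<close> of \<open>w\<close> is the multiplier \<open>v / c\<close> of \<open>c * w\<close>; so \<open>F\<close> is the exceptional set of
      \<open>c * w\<close> expressed in multipliers of \<open>w\<close>. For \<open>v\<close> in \<open>{2..4}\<close> both \<open>v\<close> and \<open>v / c\<close> lie in \<open>{1..4}\<close>.\<close>
    define F where "F = (\<lambda>x. c * x) ` E (c * w)"
    have F_lm: "F \<in> lmeasurable" and F: "measure lebesgue F = c * measure lebesgue (E (c * w))"
    proof -
      have "F = (*\<^sub>R) (1 / c) -` E (c * w) \<inter> space lebesgue"
        using c by (auto simp: F_def image_iff field_simps intro!: bexI[where x = "_ / c"])
      also have "\<dots> \<in> sets lebesgue"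
        using E_lm by (intro measurable_sets[OF lebesgue_measurable_scaling]) auto
      finally have "F \<in> sets lebesgue" .
      moreover have "emeasure lebesgue F = ennreal \<bar>c\<bar> * emeasure lebesgue (E (c * w))"
        using emeasure_lebesgue_affine[of c 0 "E (c * w)"] by (simp add: F_def)
      ultimately show "F \<in> lmeasurable"
        using E_lm[of "c * w"] by (auto simp: fmeasurable_def ennreal_mult_less_top)
      show "measure lebesgue F = c * measure lebesgue (E (c * w))"
        using measure_lebesgue_affine[of c 0 "E (c * w)"] c by (simp add: F_def)
    qed
    have "measure lebesgue (E w \<union> F) \<le> measure lebesgue (E w) + measure lebesgue F"
      using E_lm F_lm by (intro measure_Un_le) auto
    also have "\<dots> < 1/2 + 2 * (1/2)"
      unfolding F
      by (intro add_strict_mono d mult_le_less_imp_less) (use w cw c in auto)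
    also have "\<dots> < measure lebesgue {2..4::real}" by simp
    finally have "\<not> {2..4} \<subseteq> E w \<union> F"
      using measure_mono_fmeasurable[of "{2..4}" "E w \<union> F" lebesgue] E_lm F_lm by force
    then obtain v where v: "v \<in> {2..4}" "v \<notin> E w" "v \<notin> F" by blast
    have "v / c \<notin> E (c * w)" using v c by (auto simp: F_def image_iff)
    moreover have "v / c \<in> {1..4}" using v c by (auto simp: field_simps)
    moreover have "v / c * (c * w) = v * w" using c by simp
    ultimately have "f (c * w) \<le> 2 * f (v * w) \<and> f (v * w) \<le> 2 * f (c * w)"
      by (simp add: E_def)
    moreover have "f w \<le> 2 * f (v * w) \<and> f (v * w) \<le> 2 * f w"
      using v by (simp add: E_def)
    ultimately show ?thesis by linarith
  qed
  then show ?thesis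
    using d(1) unfolding eventually_at_right_field by (intro exI[of _ "d / 2"]) auto
qed

text \<open>
  Extending \<open>L\<close> by zero outside the interval on which it is positive and measurable gives a
  function on the whole line with the same ratios near \<open>0\<close>. Multipliers below \<open>1\<close> reduce to those
  above \<open>1\<close> by exchanging \<open>w\<close> and \<open>c * w\<close>.
\<close>

lemma slowly_varying_locally_bounded:
  assumes "slowly_varying_at_0 L"
  shows "\<forall>\<^sub>F w in at_right 0. L w > 0 \<and> (\<forall>c\<in>{1/2..2}. L w \<le> 4 * L (c * w))"
proof -
  obtain d where d: "d > 0" "\<And>w. w \<in> {0<..<d} \<Longrightarrow> L w > 0" "L \<in> borel_measurable (lebesgue_on {0<..<d})"
    and sv: "\<And>c. c > 0 \<Longrightarrow> ((\<lambda>w. L (c * w) / L w) \<longlongrightarrow> 1) (at_right 0)"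
    using assms unfolding slowly_varying_at_0_def by auto
  define f where "f w = indicator {0<..<d} w *\<^sub>R L w" for w
  have f_eq: "f w = L w" if "0 < w" "w < d" for w using that by (simp add: f_def)
  have meas: "f \<in> borel_measurable lebesgue"
    unfolding f_def using d(3) by (subst (asm) borel_measurable_restrict_space_iff) auto
  have pos: "\<forall>\<^sub>F w in at_right 0. f w > 0"
    unfolding eventually_at_right_field using d by (intro exI[of _ d]) (auto simp: f_eq)
  have "\<forall>\<^sub>F w in at_right 0. \<forall>c\<in>{1..2}. f w \<le> 4 * f (c * w) \<and> f (c * w) \<le> 4 * f w"
  proof (rule locally_bounded_ratio[OF meas pos])
    fix c :: real assume c: "c > 0"
    have "\<forall>\<^sub>F w in at_right 0. L (c * w) / L w = f (c * w) / f w"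
      unfolding eventually_at_right_field using c d(1)
      by (intro exI[of _ "min d (d / c)"]) (auto simp: f_eq field_simps)
    from Lim_transform_eventually[OF sv[OF c] this]
    show "((\<lambda>w. f (c * w) / f w) \<longlongrightarrow> 1) (at_right 0)" .
  qed
  then obtain e where e: "e > 0"
    "\<And>w c. 0 < w \<Longrightarrow> w < e \<Longrightarrow> c \<in> {1..2} \<Longrightarrow> f w \<le> 4 * f (c * w) \<and> f (c * w) \<le> 4 * f w"
    unfolding eventually_at_right_field by blast
  have "L w > 0 \<and> (\<forall>c\<in>{1/2..2}. L w \<le> 4 * L (c * w))" if w: "0 < w" "w < min d e / 2" for w
  proof (intro conjI ballI)
    show "L w > 0" using d w by auto
    fix c :: real assume c: "c \<in> {1/2..2}"
    have "c * w \<le> 2 * w" using c w by simp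
    then have "c * w < min d e" using w(2) by linarith
    then have cw: "0 < c * w" "c * w < min d e" using c w by auto
    have "f w \<le> 4 * f (c * w)"
    proof (cases "c \<ge> 1")
      case True
      then show ?thesis using e(2)[of w c] c w by auto
    next
      case False
      then have "1 / c \<in> {1..2}" "1 / c * (c * w) = w" using c by (auto simp: field_simps)
      then show ?thesis using e(2)[of "c * w" "1 / c"] cw by simp
    qed
    then show "L w \<le> 4 * L (c * w)" using cw w by (simp add: f_eq)
  qed
  then show ?thesis
    using d(1) e(1) unfolding eventually_at_right_field by (intro exI[of _ "min d e / 2"]) auto
qed

text \<open>
  Replacing \<open>x\<close> by \<open>a * x\<close> multiplies the argument of \<open>L\<close> by \<open>1 / a\<close>, again between \<open>1/2\<close> and \<open>2\<close>;
  the constant combines the factor \<open>4\<close> from \<open>L\<close> with the largest value of \<open>a powr \<rho>\<close> for \<open>a \<le> 2\<close>.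
\<close>

lemma regularly_varying_comparison:
  assumes sv: "slowly_varying_at_0 L" and \<rho>: "\<rho> \<ge> 0"
    and \<zeta>: "\<And>x. x > 0 \<Longrightarrow> \<zeta> x = (1 / x) powr \<rho> * L (1 / x)"
  shows "\<forall>\<^sub>F x in at_top. \<forall>a\<in>{1/2..2}. \<bar>\<zeta> x\<bar> \<le> 4 * 2 powr \<rho> * \<bar>\<zeta> (a * x)\<bar>"
proof -
  have "\<forall>\<^sub>F x in at_top. L (inverse x) > 0 \<and> (\<forall>c\<in>{1/2..2}. L (inverse x) \<le> 4 * L (c * inverse x))"
    using slowly_varying_locally_bounded[OF sv] unfolding eventually_at_right_to_top .
  then show ?thesis using eventually_gt_at_top[of 0]
  proof eventually_elim
    case (elim x)
    show ?case
    proof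
      fix a :: real assume a: "a \<in> {1/2..2}"
      then have "1 / a \<in> {1/2..2}" by (auto simp: field_simps)
      then have L: "L (1 / x) > 0" "L (1 / x) \<le> 4 * L (1 / (a * x))"
        using elim(1)[THEN conjunct1] elim(1)[THEN conjunct2, rule_format, of "1 / a"]
        by (auto simp: field_simps)
      have "(1 / x) powr \<rho> = a powr \<rho> * (1 / (a * x)) powr \<rho>"
        using a elim(2) by (simp add: powr_mult [symmetric])
      also have "\<dots> \<le> 2 powr \<rho> * (1 / (a * x)) powr \<rho>"
        using a \<rho> by (intro mult_right_mono powr_mono2) auto
      finally have "(1 / x) powr \<rho> * L (1 / x) \<le> (2 powr \<rho> * (1 / (a * x)) powr \<rho>) * (4 * L (1 / (a * x)))"
        using L by (intro mult_mono) auto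
      then show "\<bar>\<zeta> x\<bar> \<le> 4 * 2 powr \<rho> * \<bar>\<zeta> (a * x)\<bar>"
        using a elim(2) L by (simp add: \<zeta> abs_mult mult_ac)
    qed
  qed
qed

section \<open>The upper tail quantile function\<close>

text \<open>
  Strict monotonicity keeps \<open>g\<close> strictly below its limit \<open>1\<close>, so continuity makes \<open>g\<close> a bijection
  from \<open>{A..}\<close> onto \<open>{g A..<1}\<close>; as \<open>u\<close> passes each \<open>g Z < 1\<close>, its preimage passes \<open>Z\<close>.
\<close>

lemma upper_tail_quantile:
  fixes g h :: "real \<Rightarrow> real"
  assumes cdf: "cdf_on_tail A g" and cont: "continuous_on {A..} g" and mono: "strict_mono_on {A..} g"
    and h: "\<forall>u\<in>{g A..<1}. h u = the_inv_into {A..} g u"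
  shows "filterlim h at_top (at_left 1)" and "\<forall>\<^sub>F u in at_left 1. g (h u) = u"
proof -
  obtain M where M: "real_distribution M" "\<And>x. x \<ge> A \<Longrightarrow> g x = cdf M x"
    using cdf unfolding cdf_on_tail_def by blast
  interpret real_distribution M by (rule M)
  have less: "g x < g y \<longleftrightarrow> x < y" if "x \<ge> A" "y \<ge> A" for x y
    using that mono strict_mono_on_less[of "{A..}" g x y] by simp
  have less1: "g x < 1" if "x \<ge> A" for x
  proof -
    have "g x < g (x + 1)" using that by (simp add: less)
    also have "\<dots> \<le> 1" using that by (simp add: M cdf_bounded_prob)
    finally show ?thesis .
  qed
  have lim: "(g \<longlongrightarrow> 1) at_top"
    using cdf_lim_at_top_prob eventually_mono[OF eventually_ge_at_top[of A]]
    by (rule Lim_transform_eventually) (simp add: M)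
  have inj: "inj_on g {A..}" using mono by (rule strict_mono_on_imp_inj_on)
  have *: "h u \<ge> A \<and> g (h u) = u" if u: "u \<in> {g A..<1}" for u
  proof -
    have "\<forall>\<^sub>F x in at_top. g x > u" using lim u by (intro order_tendstoD(1)) auto
    then have "\<forall>\<^sub>F x in at_top. g x > u \<and> x \<ge> A" using eventually_ge_at_top[of A] by eventually_elim simp
    then obtain b where b: "g b > u" "b \<ge> A" using eventually_happens by force
    have "\<exists>x. A \<le> x \<and> x \<le> b \<and> g x = u"
      using b u by (intro IVT' continuous_on_subset[OF cont]) auto
    then obtain x where x: "x \<ge> A" "g x = u" by blast
    then have "h u = x" using h u the_inv_into_f_eq[OF inj, of x u] by simp
    with x show ?thesis by simp
  qed
  have near1: "\<forall>\<^sub>F u in at_left 1. u \<in> {b..<1}" if "b < 1" for b :: real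
    using that unfolding eventually_at_left_field by (intro exI[of _ b]) auto
  show "\<forall>\<^sub>F u in at_left 1. g (h u) = u"
    using near1[OF less1[OF order_refl]] by eventually_elim (simp add: *)
  show "filterlim h at_top (at_left 1)"
    unfolding filterlim_at_top
  proof
    fix Z :: real
    have "\<forall>\<^sub>F u in at_left 1. u \<in> {g (max A Z)..<1}" by (intro near1 less1) simp
    moreover have "\<forall>\<^sub>F u in at_left 1. u \<in> {g A..<1}" by (intro near1 less1) simp
    ultimately show "\<forall>\<^sub>F u in at_left 1. Z \<le> h u"
    proof eventually_elim
      case (elim u)
      then show ?case using *[of u] less[of "h u" "max A Z"] by auto
    qed
  qed
qed

section \<open>Inversion of the asymptotic relation\<close>

theorem corollary1:
  fixes A \<rho> :: real and g y h \<zeta> \<psi> L :: "real \<Rightarrow> real"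
  assumes "A > 0"
    and "cdf_on_tail A g"
    and "\<forall>x\<ge>A. g x > 0"
    and "continuous_on {A..} g"
    and "strict_mono_on {A..} g"
    and "filterlim y at_top (at_left 1)"
    and "(\<lambda>x. y (g x) / x - 1) \<in> O[at_top](\<zeta>)"
    and "(\<zeta> \<longlongrightarrow> 0) at_top"
    and "\<forall>x>0. \<zeta> x = \<psi> (1 / x)"
    and "\<forall>w>0. \<psi> w = w powr \<rho> * L w"
    and "\<rho> \<ge> 0"
    and "slowly_varying_at_0 L"
    and "\<forall>u\<in>{g A..<1}. h u = the_inv_into {A..} g u"
  shows "(\<lambda>u. h u / y u - 1) \<in> O[at_left 1](\<lambda>u. \<zeta> (y u))"
proof -
  obtain C where C: "C > 0" "\<forall>\<^sub>F x in at_top. norm (y (g x) / x - 1) \<le> C * norm (\<zeta> x)"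
    using assms(7) by (elim landau_o.bigE)
  have "((\<lambda>x. y (g x) / x - 1) \<longlongrightarrow> 0) at_top"
    by (rule tendsto_0_le[OF assms(8), where K = C]) (use C(2) in \<open>simp add: mult.commute\<close>)
  then have half: "\<forall>\<^sub>F x in at_top. \<bar>y (g x) / x - 1\<bar> < 1/2"
    by (auto dest: tendstoD[where e = "1/2"])
  define K where "K = 4 * 2 powr \<rho>"
  have comp: "\<forall>\<^sub>F x in at_top. \<forall>a\<in>{1/2..2}. \<bar>\<zeta> x\<bar> \<le> K * \<bar>\<zeta> (a * x)\<bar>"
    unfolding K_def using assms(9-12) by (intro regularly_varying_comparison[where L = L]) auto
  have "\<forall>\<^sub>F x in at_top. \<bar>x / y (g x) - 1\<bar> \<le> 2 * C * K * \<bar>\<zeta> (y (g x))\<bar>"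
    using C(2) half comp eventually_gt_at_top[of 0]
  proof eventually_elim
    case (elim x)
    define a where "a = y (g x) / x"
    have y: "y (g x) = a * x" using elim(4) by (simp add: a_def)
    have "\<bar>a - 1\<bar> < 1/2" using elim(2) by (simp add: a_def)
    then have a: "a \<in> {1/2..2}" unfolding atLeastAtMost_iff by linarith
    have a1: "\<bar>a - 1\<bar> \<le> C * \<bar>\<zeta> x\<bar>" using elim(1) by (simp add: a_def)
    have "\<bar>x / y (g x) - 1\<bar> = \<bar>a - 1\<bar> / a"
      using a elim(4) by (simp add: y abs_if divide_simps)
    also have "\<dots> \<le> \<bar>a - 1\<bar> / (1/2)" using a by (intro divide_left_mono) auto
    also have "\<dots> \<le> 2 * (C * \<bar>\<zeta> x\<bar>)" using a1 by simp
    also have "\<dots> \<le> 2 * (C * (K * \<bar>\<zeta> (a * x)\<bar>))" using elim(3) a C(1) by simp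
    finally show ?case by (simp add: y mult_ac)
  qed
  then have "\<forall>\<^sub>F u in at_left 1. \<bar>h u / y (g (h u)) - 1\<bar> \<le> 2 * C * K * \<bar>\<zeta> (y (g (h u)))\<bar>"
    by (rule eventually_compose_filterlim) (rule upper_tail_quantile(1)[OF assms(2,4,5,13)])
  then have "\<forall>\<^sub>F u in at_left 1. norm (h u / y u - 1) \<le> 2 * C * K * norm (\<zeta> (y u))"
    using upper_tail_quantile(2)[OF assms(2,4,5,13)] by eventually_elim simp
  then show ?thesis by (rule bigoI)
qed

end
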